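(* Let $\mathcal{A}\in\mathbb{R}^{p\times p}$ be a symmetric positive definite matrix, let $\mathcal{H}=\mathcal{A}^{-1}$, and let $\mathcal{I}_1,\mathcal{I}_2$ be (nonempty) index sets with $\mathcal{I}_1\cup\mathcal{I}_2=\{1,2,\ldots,p\}$ and $\mathcal{I}_1\cap\mathcal{I}_2=\emptyset$. Let $\tilde{\mathcal{H}}^{(r,2)}\in\mathbb{R}^{p\times p}$ be the approximation of $\mathcal{H}$ after $r$ complete iterations of the two-block iterative block matrix inversion (IBMI) algorithm with sets $\mathcal{I}_1$ and $\mathcal{I}_2$. Then $\tilde{\mathcal{H}}^{(r,2)}$ converges to $\mathcal{H}$ as $r\to\infty$ for any symmetric positive definite initial guess $\tilde{\mathcal{H}}^{(0,2)}_{\mathcal{I}_2}\in\mathbb{R}^{|\mathcal{I}_2|\times|\mathcal{I}_2|}$.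
   Context: Notation: for index sets $\mathcal{I},\mathcal{J}\subseteq\{1,\ldots,p\}$ and a $p\times p$ matrix $M$, $M_{\mathcal{I},\mathcal{J}}$ is the sub-matrix of $M$ with rows indexed by $\mathcal{I}$ and columns indexed by $\mathcal{J}$, and $M_{\mathcal{I}}=M_{\mathcal{I},\mathcal{I}}$. In particular $\mathcal{A}_{\mathcal{I}}^{-1}$ means $(\mathcal{A}_{\mathcal{I}})^{-1}$. Superscripts $(r,k)$ on $\tilde{\mathcal{H}}$ are labels (iteration $r$, set $k$), not powers. Two-block IBMI algorithm (non-overlapping case, $\mathcal{I}_1^c=\mathcal{I}_2$, $\mathcal{I}_2^c=\mathcal{I}_1$). Given an initial guess $\tilde{\mathcal{H}}^{(0,2)}_{\mathcal{I}_2}$ for $\mathcal{H}_{\mathcal{I}_2}$, iteration $r=1,2,\ldots$ consists of two steps. Step $k=1$: form the $p\times p$ matrix $\tilde{\mathcal{H}}^{(r,1)}$ whose blocks are $\tilde{\mathcal{H}}^{(r,1)}_{\mathcal{I}_1}=\mathcal{A}_{\mathcal{I}_1}^{-1}+\mathcal{A}_{\mathcal{I}_1}^{-1}\mathcal{A}_{\mathcal{I}_1,\mathcal{I}_2}\tilde{\mathcal{H}}^{(r-1,2)}_{\mathcal{I}_2}\mathcal{A}_{\mathcal{I}_2,\mathcal{I}_1}\mathcal{A}_{\mathcal{I}_1}^{-1}$, $\tilde{\mathcal{H}}^{(r,1)}_{\mathcal{I}_1,\mathcal{I}_2}=-\mathcal{A}_{\mathcal{I}_1}^{-1}\mathcal{A}_{\mathcal{I}_1,\mathcal{I}_2}\tilde{\mathcal{H}}^{(r-1,2)}_{\mathcal{I}_2}$,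 $\tilde{\mathcal{H}}^{(r,1)}_{\mathcal{I}_2,\mathcal{I}_1}=-\tilde{\mathcal{H}}^{(r-1,2)}_{\mathcal{I}_2}\mathcal{A}_{\mathcal{I}_2,\mathcal{I}_1}\mathcal{A}_{\mathcal{I}_1}^{-1}$, $\tilde{\mathcal{H}}^{(r,1)}_{\mathcal{I}_2}=\tilde{\mathcal{H}}^{(r-1,2)}_{\mathcal{I}_2}$. Step $k=2$: form the $p\times p$ matrix $\tilde{\mathcal{H}}^{(r,2)}$ whose blocks are $\tilde{\mathcal{H}}^{(r,2)}_{\mathcal{I}_2}=\mathcal{A}_{\mathcal{I}_2}^{-1}+\mathcal{A}_{\mathcal{I}_2}^{-1}\mathcal{A}_{\mathcal{I}_2,\mathcal{I}_1}\tilde{\mathcal{H}}^{(r,1)}_{\mathcal{I}_1}\mathcal{A}_{\mathcal{I}_1,\mathcal{I}_2}\mathcal{A}_{\mathcal{I}_2}^{-1}$, $\tilde{\mathcal{H}}^{(r,2)}_{\mathcal{I}_2,\mathcal{I}_1}=-\mathcal{A}_{\mathcal{I}_2}^{-1}\mathcal{A}_{\mathcal{I}_2,\mathcal{I}_1}\tilde{\mathcal{H}}^{(r,1)}_{\mathcal{I}_1}$, $\tilde{\mathcal{H}}^{(r,2)}_{\mathcal{I}_1,\mathcal{I}_2}=-\tilde{\mathcal{H}}^{(r,1)}_{\mathcal{I}_1}\mathcal{A}_{\mathcal{I}_1,\mathcal{I}_2}\mathcal{A}_{\mathcal{I}_2}^{-1}$, $\tilde{\mathcal{H}}^{(r,2)}_{\mathcal{I}_1}=\tilde{\mathcal{H}}^{(r,1)}_{\mathcal{I}_1}$.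 The iterates are considered for all $r\ge 1$ (no stopping criterion is applied). *)

theory Defs
  imports
    Complex_Main
    "Jordan_Normal_Form.DL_Submatrix"
    "Jordan_Normal_Form.Gauss_Jordan_Elimination"
begin

definition symmetric_mat :: "'a mat \<Rightarrow> bool" where
  "symmetric_mat A \<longleftrightarrow> square_mat A \<and> transpose_mat A = A"

definition spd_mat :: "real mat \<Rightarrow> bool" where
  "spd_mat A \<longleftrightarrow> symmetric_mat A \<and>
     (\<forall>x \<in> carrier_vec (dim_row A). x \<noteq> 0\<^sub>v (dim_row A) \<longrightarrow> x \<bullet> (A *\<^sub>v x) > 0)"

(* Meaningful only for invertible A: mat_inverse returns None on all other matrices. *)
definition mat_inv :: "'a :: field mat \<Rightarrow> 'a mat" where
  "mat_inv A = the (mat_inverse A)"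

lemma mat_inv_eqI:
  assumes "A \<in> carrier_mat n n" "B \<in> carrier_mat n n" "A * B = 1\<^sub>m n" "B * A = 1\<^sub>m n"
  shows "mat_inv A = B"
proof (cases "mat_inverse A")
  case None
  have "A \<in> Units (ring_mat TYPE('a) n ())"
    using assms unfolding Units_def ring_mat_def by auto
  with mat_inverse(1)[OF assms(1) None, where b = "()"] show ?thesis by blast
next
  case (Some C)
  from mat_inverse(2)[OF assms(1) Some]
  have C: "C \<in> carrier_mat n n" "C * A = 1\<^sub>m n" by auto
  have "C = C * (A * B)" using C assms by simp
  also have "\<dots> = (C * A) * B" using assoc_mult_mat[OF C(1) assms(1,2)] by simp
  also have "\<dots> = B" using C assms by simp
  finally show ?thesis using Some by (simp add: mat_inv_def)
qed

(* The inverse of pick I: the position of the index i within the increasing enumeration of I. *)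
definition index_pos :: "nat set \<Rightarrow> nat \<Rightarrow> nat" where
  "index_pos I i = card {a \<in> I. a < i}"

(* The p x p matrix M with M_I = B11, M_{I,J} = B12, M_{J,I} = B21, M_J = B22, where {I, J} is a
   partition of {0..<p}; I and J need not be contiguous, in contrast to four_block_mat. *)
definition mat_of_blocks ::
  "nat \<Rightarrow> nat set \<Rightarrow> nat set \<Rightarrow> 'a mat \<Rightarrow> 'a mat \<Rightarrow> 'a mat \<Rightarrow> 'a mat \<Rightarrow> 'a mat" where
  "mat_of_blocks p I J B11 B12 B21 B22 = mat p p (\<lambda>(i, j).
     if i \<in> I then
       if j \<in> I then B11 $$ (index_pos I i, index_pos I j)
       else B12 $$ (index_pos I i, index_pos J j)
     else
       if j \<in> I then B21 $$ (index_pos J i, index_pos I j)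
       else B22 $$ (index_pos J i, index_pos J j))"

lemma index_pos_pick: "k < card I \<Longrightarrow> index_pos I (pick I k) = k"
  unfolding index_pos_def by (rule card_pick) simp

lemma submatrix_mat_of_blocks:
  assumes "I \<union> J = {0..<p}" "I \<inter> J = {}"
    and "B11 \<in> carrier_mat (card I) (card I)" "B12 \<in> carrier_mat (card I) (card J)"
    and "B21 \<in> carrier_mat (card J) (card I)" "B22 \<in> carrier_mat (card J) (card J)"
  defines "M \<equiv> mat_of_blocks p I J B11 B12 B21 B22"
  shows "submatrix M I I = B11" "submatrix M I J = B12"
    "submatrix M J I = B21" "submatrix M J J = B22"
proof -
  have sets: "{i. i < p \<and> i \<in> I} = I" "{i. i < p \<and> i \<in> J} = J"
    using assms(1) by auto
  have I: "pick I k \<in> I" "pick I k < p" if "k < card I" for k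
    using pick_in_set[of k I] that assms(1) by auto
  have J: "pick J k \<in> J" "pick J k < p" "pick J k \<notin> I" if "k < card J" for k
    using pick_in_set[of k J] that assms(1,2) by auto
  show "submatrix M I I = B11" "submatrix M I J = B12"
    "submatrix M J I = B21" "submatrix M J J = B22"
    using assms(3-6)
    by (auto intro!: eq_matI
        simp: M_def submatrix_def mat_of_blocks_def sets I J index_pos_pick)
qed

(* One step of the method. The step k = 1 is ibmi_step p A I1 I2, and k = 2 is
   ibmi_step p A I2 I1; X is the current approximation of the J-block of the inverse of A. *)
definition ibmi_step ::
  "nat \<Rightarrow> real mat \<Rightarrow> nat set \<Rightarrow> nat set \<Rightarrow> real mat \<Rightarrow> real mat" where
  "ibmi_step p A I J X =
     (let AI = mat_inv (submatrix A I I); AIJ = submatrix A I J; AJI = submatrix A J I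
      in mat_of_blocks p I J
           (AI + AI * AIJ * X * AJI * AI) (- (AI * AIJ * X))
           (- (X * AJI * AI))             X)"

(* ibmi p A I1 I2 X0 r is the approximation of the inverse of A after r complete iterations.
   For r = 0 only the I2-block, the initial guess X0, is ever used; the zeros are fillers. *)
primrec ibmi ::
  "nat \<Rightarrow> real mat \<Rightarrow> nat set \<Rightarrow> nat set \<Rightarrow> real mat \<Rightarrow> nat \<Rightarrow> real mat" where
  "ibmi p A I1 I2 X0 0 =
     mat_of_blocks p I1 I2 (0\<^sub>m (card I1) (card I1)) (0\<^sub>m (card I1) (card I2))
                           (0\<^sub>m (card I2) (card I1)) X0"
| "ibmi p A I1 I2 X0 (Suc r) =
     (let H1 = ibmi_step p A I1 I2 (submatrix (ibmi p A I1 I2 X0 r) I2 I2)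
      in ibmi_step p A I2 I1 (submatrix H1 I1 I1))"

(* Type mat carries no topology; for a fixed format, convergence in any matrix norm is
   entrywise convergence. *)
definition mat_tendsto :: "(nat \<Rightarrow> real mat) \<Rightarrow> real mat \<Rightarrow> bool" where
  "mat_tendsto X L \<longleftrightarrow>
     (\<forall>\<^sub>F r in sequentially. X r \<in> carrier_mat (dim_row L) (dim_col L)) \<and>
     (\<forall>i < dim_row L. \<forall>j < dim_col L. (\<lambda>r. X r $$ (i, j)) \<longlonglongrightarrow> L $$ (i, j))"

end

theory Submission
  imports Defs "Jordan_Normal_Form.Determinant"
begin

text \<open>Measure vectors by the norm $|x|_A^2 = x \cdot A x$. For an index set $I$ let $G_I$ be the
  inverse of the block $A_I$, padded with zeros to size $p$. Then $G_I A$ is the $A$-orthogonal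
  projection onto the vectors supported on $I$, and $D_I = 1 - G_I A$ is the complementary one. The
  block formulas of one step say exactly that the new approximation is
  $G_I + D_I Z D_I^T$, where $Z$ is the old one: since $D_I$ annihilates the vectors supported on
  $I$, only the block of $Z$ on the complement $J$ of $I$ enters (\<open>ibmi_step_eq\<close>). The inverse $H$
  of $A$ is a fixed point of this affine map, so the error $Z - H$ is merely conjugated by $D_I$,
  and a complete iteration conjugates it by $T = D_J D_I$ (\<open>ibmi_error\<close>). This is von Neumann's
  method of alternating projections, and everything follows from $T^r \rightarrow 0$.

  A uniform contraction $|T x|_A^2 \le q |x|_A^2$ with $q < 1$ holds for the following reason
  (\<open>residual_contraction\<close>). Let $y = D_I x$. The vector $w = A y$ vanishes on $I$. The second
  projection removes $z = G_J w$ from $y$, and by Pythagoras $|D_J y|_A^2 = |y|_A^2 - |z|_A^2$. So $z$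
  must not be small compared with $y$. As $w$ is supported on $J$, where $A G_J$ acts as the
  identity, $w \cdot w = w \cdot A z$, and the Cauchy-Schwarz inequality bounds $w \cdot w$ by a
  multiple of $|z|_A^2$. Finally $|y|_A^2 = w \cdot H w$ is at most a multiple of $w \cdot w$.\<close>

section \<open>Matrix algebra with side conditions on dimensions\<close>

text \<open>With carrier sets as hypotheses, the laws for products leave the simplifier to guess
  dimensions that do not occur in the term it rewrites. Equations between dimensions, in
  contrast, it verifies by computation, also for nested products.\<close>

lemma assoc_mult_dim:
  "dim_col A = dim_row B \<Longrightarrow> dim_col B = dim_row C \<Longrightarrow> A * B * C = A * (B * C)"
  by (rule assoc_mult_mat[OF carrier_matI carrier_matI carrier_matI]) auto

lemma add_mult_dim:
  fixes A :: "'a :: semiring_0 mat"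
  assumes "dim_row A = dim_row B" "dim_col A = dim_col B" "dim_col B = dim_row C"
  shows "(A + B) * C = A * C + B * C"
  by (rule add_mult_distrib_mat[of _ "dim_row B" "dim_col B"]) (use assms in auto)

lemma mult_add_dim:
  fixes A :: "'a :: semiring_0 mat"
  assumes "dim_row B = dim_row C" "dim_col B = dim_col C" "dim_col A = dim_row C"
  shows "A * (B + C) = A * B + A * C"
  by (rule mult_add_distrib_mat[of _ "dim_row A" "dim_row C" _ "dim_col C"]) (use assms in auto)

lemma minus_mult_dim:
  fixes A :: "'a :: ring mat"
  assumes "dim_row A = dim_row B" "dim_col A = dim_col B" "dim_col B = dim_row C"
  shows "(A - B) * C = A * C - B * C"
  by (rule minus_mult_distrib_mat[of _ "dim_row B" "dim_col B"]) (use assms in auto)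

lemma mult_minus_dim:
  fixes A :: "'a :: ring mat"
  assumes "dim_row B = dim_row C" "dim_col B = dim_col C" "dim_col A = dim_row C"
  shows "A * (B - C) = A * B - A * C"
  by (rule mult_minus_distrib_mat[of _ "dim_row A" "dim_row C" _ "dim_col C"]) (use assms in auto)

lemma mult_one_dim:
  fixes A :: "'a :: semiring_1 mat"
  shows "dim_col A = n \<Longrightarrow> A * 1\<^sub>m n = A" "dim_row A = n \<Longrightarrow> 1\<^sub>m n * A = A"
  by (intro right_mult_one_mat carrier_matI left_mult_one_mat; simp)+

lemma minus_self_dim:
  fixes A :: "'a :: group_add mat"
  shows "A - A = 0\<^sub>m (dim_row A) (dim_col A)"
  by (intro eq_matI) auto

lemma zero_add_dim:
  fixes A :: "'a :: monoid_add mat"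
  shows "dim_row A = m \<Longrightarrow> dim_col A = n \<Longrightarrow> 0\<^sub>m m n + A = A"
  by (intro eq_matI) auto

lemma transpose_mult_dim:
  fixes A :: "'a :: comm_semiring_0 mat"
  shows "dim_col A = dim_row B \<Longrightarrow> (A * B)\<^sup>T = B\<^sup>T * A\<^sup>T"
  by (rule transpose_mult[OF carrier_matI carrier_matI]) auto

lemma assoc_mult_vec_dim:
  "dim_col A = dim_row B \<Longrightarrow> dim_col B = dim_vec v \<Longrightarrow> A * B *\<^sub>v v = A *\<^sub>v (B *\<^sub>v v)"
  by (rule assoc_mult_mat_vec[OF carrier_matI carrier_matI carrier_vecI]) (rule refl | assumption | simp)+

lemmas mat_ring_simps =
  assoc_mult_dim add_mult_dim mult_add_dim minus_mult_dim mult_minus_dim mult_one_dim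

lemma scalar_prod_transpose:
  fixes B :: "'a :: comm_semiring_0 mat"
  assumes "B \<in> carrier_mat m n" "x \<in> carrier_vec m" "y \<in> carrier_vec n"
  shows "x \<bullet> (B *\<^sub>v y) = (B\<^sup>T *\<^sub>v x) \<bullet> y"
  using transpose_vec_mult_scalar[OF assms(1,3,2)] by simp

section \<open>The norm of a positive definite matrix\<close>

lemma spd_matD:
  assumes "spd_mat A" "A \<in> carrier_mat n n"
  shows "A\<^sup>T = A"
    and "x \<in> carrier_vec n \<Longrightarrow> x \<noteq> 0\<^sub>v n \<Longrightarrow> x \<bullet> (A *\<^sub>v x) > 0"
    and "x \<in> carrier_vec n \<Longrightarrow> x \<bullet> (A *\<^sub>v x) \<ge> 0"
proof -
  show "A\<^sup>T = A" using assms by (simp add: spd_mat_def symmetric_mat_def)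
  show pos: "x \<bullet> (A *\<^sub>v x) > 0" if "x \<in> carrier_vec n" "x \<noteq> 0\<^sub>v n"
    using assms that by (auto simp: spd_mat_def)
  show "x \<bullet> (A *\<^sub>v x) \<ge> 0" if "x \<in> carrier_vec n"
    using pos[OF that] assms(2) by (cases "x = 0\<^sub>v n") (auto intro: less_imp_le)
qed

text \<open>Definiteness makes the kernel trivial. The transposed inverse is again an inverse of the
  symmetric matrix \<^term>\<open>A\<close>, so it is the inverse.\<close>

lemma spd_mat_inverse:
  assumes A: "A \<in> carrier_mat n n" and spd: "spd_mat A"
  shows "mat_inv A \<in> carrier_mat n n" "A * mat_inv A = 1\<^sub>m n" "mat_inv A * A = 1\<^sub>m n"
    and "(mat_inv A)\<^sup>T = mat_inv A"
proof -
  have "det A \<noteq> 0"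
  proof
    assume "det A = 0"
    then obtain v where v: "v \<in> carrier_vec n" "v \<noteq> 0\<^sub>v n" "A *\<^sub>v v = 0\<^sub>v n"
      using det_0_iff_vec_prod_zero[OF A] by auto
    with spd_matD(2)[OF spd A v(1,2)] show False by simp
  qed
  then have "A \<in> Units (ring_mat TYPE(real) n ())" by (rule det_non_zero_imp_unit[OF A])
  then obtain B where "mat_inverse A = Some B" using mat_inverse(1)[OF A, of "()"] by (cases "mat_inverse A") auto
  with mat_inverse(2)[OF A this]
  show inv: "mat_inv A \<in> carrier_mat n n" "A * mat_inv A = 1\<^sub>m n" "mat_inv A * A = 1\<^sub>m n"
    by (auto simp: mat_inv_def)
  let ?H = "mat_inv A"
  have sym: "A\<^sup>T = A" by (rule spd_matD(1)[OF spd A])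
  have "(A * ?H)\<^sup>T = 1\<^sub>m n" "(?H * A)\<^sup>T = 1\<^sub>m n" using inv by auto
  then have "?H\<^sup>T * A = 1\<^sub>m n" "A * ?H\<^sup>T = 1\<^sub>m n"
    using A inv(1) by (auto simp: transpose_mult_dim sym)
  with mat_inv_eqI[of A n "?H\<^sup>T"] A inv(1) show "?H\<^sup>T = ?H" by auto
qed

lemma spd_Cauchy_Schwarz:
  assumes A: "A \<in> carrier_mat n n" and spd: "spd_mat A"
    and x: "x \<in> carrier_vec n" and y: "y \<in> carrier_vec n"
  shows "(x \<bullet> (A *\<^sub>v y))\<^sup>2 \<le> (x \<bullet> (A *\<^sub>v x)) * (y \<bullet> (A *\<^sub>v y))"
proof (cases "y = 0\<^sub>v n")
  case True
  moreover have "A *\<^sub>v 0\<^sub>v n = 0\<^sub>v n" using A by (intro eq_vecI) auto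
  ultimately show ?thesis using A x by simp
next
  case False
  define a b c where "a = x \<bullet> (A *\<^sub>v x)" and "b = x \<bullet> (A *\<^sub>v y)" and "c = y \<bullet> (A *\<^sub>v y)"
  have sym: "y \<bullet> (A *\<^sub>v x) = b"
    using scalar_prod_transpose[OF A y x] spd_matD(1)[OF spd A] comm_scalar_prod[of x n "A *\<^sub>v y"]
      A x y by (simp add: b_def)
  have c: "c > 0" unfolding c_def by (rule spd_matD(2)[OF spd A y False])
  \<comment> \<open>Up to the factor \<^term>\<open>c\<close>, the part of \<^term>\<open>x\<close> that is orthogonal to \<^term>\<open>y\<close>.\<close>
  let ?z = "c \<cdot>\<^sub>v x - b \<cdot>\<^sub>v y"
  have Ax: "A *\<^sub>v x \<in> carrier_vec n" "A *\<^sub>v y \<in> carrier_vec n" using A x y by auto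
  have "A *\<^sub>v ?z = c \<cdot>\<^sub>v (A *\<^sub>v x) - b \<cdot>\<^sub>v (A *\<^sub>v y)"
    using A x y by (simp add: mult_minus_distrib_mat_vec mult_mat_vec)
  then have "?z \<bullet> (A *\<^sub>v ?z) = c * (c * a - b * b)"
    using x y Ax sym by (simp add: minus_scalar_prod_distrib[of _ n] scalar_prod_minus_distrib[of _ n]
        a_def[symmetric] b_def[symmetric] c_def[symmetric] algebra_simps)
  with spd_matD(3)[OF spd A, of ?z] x y have "0 \<le> c * (c * a - b * b)" by simp
  with c have "0 \<le> c * a - b * b" by (simp add: zero_le_mult_iff)
  then show ?thesis by (simp add: a_def b_def c_def power2_eq_square mult.commute)
qed

lemma index_square_le_scalar_prod:
  fixes w :: "real vec"
  assumes "w \<in> carrier_vec n" "i < n"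
  shows "(w $ i)\<^sup>2 \<le> w \<bullet> w"
proof -
  have "(w $ i)\<^sup>2 \<le> (\<Sum>k = 0..<n. (w $ k)\<^sup>2)"
    by (rule member_le_sum) (use assms in auto)
  then show ?thesis using assms by (simp add: scalar_prod_def power2_eq_square)
qed

lemma quadratic_form_bounded:
  fixes B :: "real mat"
  assumes B: "B \<in> carrier_mat n n"
  obtains C where "C \<ge> 0" "\<And>w. w \<in> carrier_vec n \<Longrightarrow> w \<bullet> (B *\<^sub>v w) \<le> C * (w \<bullet> w)"
proof
  let ?C = "\<Sum>i = 0..<n. \<Sum>j = 0..<n. \<bar>B $$ (i, j)\<bar>"
  show "?C \<ge> 0" by (intro sum_nonneg) auto
  fix w :: "real vec" assume w: "w \<in> carrier_vec n"
  have "w $ i * (B $$ (i, j) * w $ j) \<le> \<bar>B $$ (i, j)\<bar> * (w \<bullet> w)" if "i < n" "j < n" for i j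
  proof -
    have "2 * \<bar>w $ i * w $ j\<bar> \<le> (w $ i)\<^sup>2 + (w $ j)\<^sup>2"
      using sum_squares_bound[of "\<bar>w $ i\<bar>" "\<bar>w $ j\<bar>"] by (simp add: abs_mult)
    also have "\<dots> \<le> 2 * (w \<bullet> w)"
      using index_square_le_scalar_prod[OF w] that by (smt (verit))
    finally have "\<bar>B $$ (i, j)\<bar> * \<bar>w $ i * w $ j\<bar> \<le> \<bar>B $$ (i, j)\<bar> * (w \<bullet> w)"
      by (intro mult_left_mono) auto
    moreover have "w $ i * (B $$ (i, j) * w $ j) \<le> \<bar>w $ i * (B $$ (i, j) * w $ j)\<bar>" by simp
    ultimately show ?thesis by (simp add: abs_mult algebra_simps)
  qed
  then have "(\<Sum>i = 0..<n. \<Sum>j = 0..<n. w $ i * (B $$ (i, j) * w $ j))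
      \<le> (\<Sum>i = 0..<n. \<Sum>j = 0..<n. \<bar>B $$ (i, j)\<bar> * (w \<bullet> w))"
    by (intro sum_mono) auto
  moreover have "w \<bullet> (B *\<^sub>v w) = (\<Sum>i = 0..<n. \<Sum>j = 0..<n. w $ i * (B $$ (i, j) * w $ j))"
    using B w by (simp add: scalar_prod_def sum_distrib_left)
  ultimately show "w \<bullet> (B *\<^sub>v w) \<le> ?C * (w \<bullet> w)"
    by (simp add: sum_distrib_right)
qed

text \<open>Cauchy-Schwarz, because $x_i$ is the $A$-inner product of $x$ with the $i$-th column of
  $A^{-1}$. In this way convergence in the norm of $A$ implies convergence of the entries.\<close>

lemma index_square_le_spd:
  assumes A: "A \<in> carrier_mat n n" and spd: "spd_mat A"
    and x: "x \<in> carrier_vec n" and i: "i < n"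
  shows "(x $ i)\<^sup>2 \<le> mat_inv A $$ (i, i) * (x \<bullet> (A *\<^sub>v x))"
proof -
  note H = spd_mat_inverse[OF A spd]
  let ?h = "mat_inv A *\<^sub>v unit_vec n i"
  have h: "?h \<in> carrier_vec n" using H(1) by auto
  have Ah: "A *\<^sub>v ?h = unit_vec n i"
    using A H(1,2) assoc_mult_vec_dim[of A "mat_inv A" "unit_vec n i"] by auto
  have "?h \<bullet> (A *\<^sub>v ?h) = mat_inv A $$ (i, i)"
    using h H(1) i unfolding Ah by simp
  moreover have "x \<bullet> (A *\<^sub>v ?h) = x $ i"
    unfolding Ah using x i by simp
  ultimately show ?thesis
    using spd_Cauchy_Schwarz[OF A spd x h] by (simp add: mult.commute)
qed

section \<open>Selecting an index set\<close>

text \<open>The isometry that embeds the vectors indexed by \<^term>\<open>I\<close> into those of length \<^term>\<open>p\<close>.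
  Taking blocks and assembling them become matrix products, so that identities between blocks
  are identities of matrix algebra.\<close>

definition selection_mat :: "nat \<Rightarrow> nat set \<Rightarrow> real mat" where
  "selection_mat p I = mat p (card I) (\<lambda>(i, k). if i = pick I k then 1 else 0)"

lemma selection_mat_dim [simp]:
  "dim_row (selection_mat p I) = p" "dim_col (selection_mat p I) = card I"
  by (simp_all add: selection_mat_def)

lemma selection_mat_carrier: "selection_mat p I \<in> carrier_mat p (card I)"
  by (simp add: selection_mat_def)

lemma selection_submatrix:
  assumes M: "M \<in> carrier_mat p p" and I: "I \<subseteq> {0..<p}" and J: "J \<subseteq> {0..<p}"
  shows "(selection_mat p I)\<^sup>T * M * selection_mat p J = submatrix M I J"
proof -
  have sets: "{i. i < p \<and> i \<in> I} = I" "{i. i < p \<and> i \<in> J} = J"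
    using I J by auto
  have pick: "pick I k < p" if "k < card I" for k
    using pick_in_set[of k I] that I by auto
  have pick': "pick J k < p" if "k < card J" for k
    using pick_in_set[of k J] that J by auto
  show ?thesis
    using M
    by (intro eq_matI) (auto simp: selection_mat_def submatrix_def sets scalar_prod_def
        if_distrib[of "\<lambda>c. c * _"] if_distrib[of "\<lambda>c. _ * c"] pick pick' cong: if_cong)
qed

lemma selection_orthonormal:
  assumes "I \<subseteq> {0..<p}"
  shows "(selection_mat p I)\<^sup>T * selection_mat p I = 1\<^sub>m (card I)"
proof -
  have sets: "{i. i < p \<and> i \<in> I} = I" using assms by auto
  have inj: "pick I k = pick I l \<longleftrightarrow> k = l" if "k < card I" "l < card I" for k l
    using that index_pos_pick by metis
  have pick: "pick I k < p" if "k < card I" for k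
    using pick_in_set[of k I] that assms by auto
  have "submatrix (1\<^sub>m p) I I = 1\<^sub>m (card I)"
    by (intro eq_matI) (auto simp: submatrix_def sets inj pick)
  with selection_submatrix[of "1\<^sub>m p" p I I] assms show ?thesis
    by (simp add: mat_ring_simps)
qed

lemma selection_partition:
  assumes IJ: "I \<union> J = {0..<p}" "I \<inter> J = {}"
  shows "selection_mat p I * (selection_mat p I)\<^sup>T + selection_mat p J * (selection_mat p J)\<^sup>T = 1\<^sub>m p"
proof -
  have diag: "(\<Sum>k = 0..<card K. (if i = pick K k then 1 else 0) * (if j = pick K k then 1 else 0))
      = (if i = j \<and> i \<in> K then 1 else 0 :: real)" if K: "finite K" for K i j
  proof -
    have "inj_on (pick K) {0..<card K}"
      by (rule inj_on_inverseI[of _ "index_pos K"]) (simp add: index_pos_pick)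
    moreover from this have "pick K ` {0..<card K} = K"
      by (intro card_subset_eq K) (auto simp: card_image pick_in_set)
    ultimately have "bij_betw (pick K) {0..<card K} K" by (simp add: bij_betw_def)
    from sum.reindex_bij_betw[OF this,
        of "\<lambda>a. (if i = a then 1 else 0) * (if j = a then 1 else 0 :: real)"]
    show ?thesis using K by (simp add: if_distrib[of "\<lambda>c. c * _"] cong: if_cong)
  qed
  have fin: "finite I" "finite J" using IJ(1) by (metis finite_Un finite_atLeastLessThan)+
  show ?thesis
    using IJ by (intro eq_matI) (auto simp: selection_mat_def scalar_prod_def diag fin)
qed

lemma mat_of_blocks_carrier: "mat_of_blocks p I J B11 B12 B21 B22 \<in> carrier_mat p p"
  by (simp add: mat_of_blocks_def)

text \<open>Multiply the matrix on both sides by the identity, split into the two coordinate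
  projections.\<close>

lemma mat_of_blocks_eq_selection:
  fixes B11 B12 B21 B22 :: "real mat"
  assumes IJ: "I \<union> J = {0..<p}" "I \<inter> J = {}"
    and B: "B11 \<in> carrier_mat (card I) (card I)" "B12 \<in> carrier_mat (card I) (card J)"
    "B21 \<in> carrier_mat (card J) (card I)" "B22 \<in> carrier_mat (card J) (card J)"
  defines "U \<equiv> selection_mat p I" and "V \<equiv> selection_mat p J"
  shows "mat_of_blocks p I J B11 B12 B21 B22
    = (U * B11 * U\<^sup>T + U * B12 * V\<^sup>T) + (V * B21 * U\<^sup>T + V * B22 * V\<^sup>T)"
proof -
  let ?M = "mat_of_blocks p I J B11 B12 B21 B22"
  have M: "?M \<in> carrier_mat p p" by (rule mat_of_blocks_carrier)
  have sub: "I \<subseteq> {0..<p}" "J \<subseteq> {0..<p}" using IJ by auto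
  note blocks = submatrix_mat_of_blocks[OF IJ B]
  have blk: "B11 = U\<^sup>T * ?M * U" "B12 = U\<^sup>T * ?M * V" "B21 = V\<^sup>T * ?M * U" "B22 = V\<^sup>T * ?M * V"
    unfolding U_def V_def by (simp_all add: selection_submatrix[OF M] sub blocks)
  have dims: "dim_row U = p" "dim_col U = card I" "dim_row V = p" "dim_col V = card J"
    by (simp_all add: U_def V_def)
  have one: "U * U\<^sup>T + V * V\<^sup>T = 1\<^sub>m p"
    unfolding U_def V_def by (rule selection_partition[OF IJ])
  have "?M = (U * U\<^sup>T + V * V\<^sup>T) * ?M * (U * U\<^sup>T + V * V\<^sup>T)"
    unfolding one using M by (simp add: mat_ring_simps)
  also have "\<dots> = (U * (U\<^sup>T * ?M * U) * U\<^sup>T + U * (U\<^sup>T * ?M * V) * V\<^sup>T)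
      + (V * (V\<^sup>T * ?M * U) * U\<^sup>T + V * (V\<^sup>T * ?M * V) * V\<^sup>T)"
    using M by (intro eq_matI) (simp_all add: mat_ring_simps dims del: index_mult_mat(1))
  finally show ?thesis by (simp only: blk[symmetric])
qed

section \<open>Inverting a principal submatrix\<close>

text \<open>The quadratic form of the submatrix is that of \<^term>\<open>A\<close>, restricted to the vectors that
  are supported on \<^term>\<open>I\<close>.\<close>

lemma spd_submatrix:
  assumes A: "A \<in> carrier_mat p p" and spd: "spd_mat A" and I: "I \<subseteq> {0..<p}"
  shows "submatrix A I I \<in> carrier_mat (card I) (card I)" "spd_mat (submatrix A I I)"
proof -
  define U where "U = selection_mat p I"
  have U: "U \<in> carrier_mat p (card I)" unfolding U_def by (rule selection_mat_carrier)
  have eq: "submatrix A I I = U\<^sup>T * A * U"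
    unfolding U_def by (rule selection_submatrix[OF A I I, symmetric])
  show carr: "submatrix A I I \<in> carrier_mat (card I) (card I)" unfolding eq using A U by simp
  have sym: "(U\<^sup>T * A * U)\<^sup>T = U\<^sup>T * A * U"
    using A U by (simp add: transpose_mult_dim assoc_mult_dim spd_matD(1)[OF spd A])
  have pos: "x \<bullet> (U\<^sup>T * A * U *\<^sub>v x) > 0" if x: "x \<in> carrier_vec (card I)" "x \<noteq> 0\<^sub>v (card I)" for x
  proof -
    have Ux: "U *\<^sub>v x \<in> carrier_vec p" using U x by auto
    have "U *\<^sub>v x \<noteq> 0\<^sub>v p"
    proof
      assume "U *\<^sub>v x = 0\<^sub>v p"
      then have "U\<^sup>T * U *\<^sub>v x = U\<^sup>T *\<^sub>v 0\<^sub>v p" using U x by (simp add: assoc_mult_vec_dim)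
      also have "\<dots> = 0\<^sub>v (card I)" using U by (intro eq_vecI) auto
      finally show False
        using x selection_orthonormal[OF I] unfolding U_def by simp
    qed
    then have "(U *\<^sub>v x) \<bullet> (A *\<^sub>v (U *\<^sub>v x)) > 0" by (rule spd_matD(2)[OF spd A Ux])
    moreover have "x \<bullet> (U\<^sup>T *\<^sub>v (A *\<^sub>v (U *\<^sub>v x))) = (U *\<^sub>v x) \<bullet> (A *\<^sub>v (U *\<^sub>v x))"
      using scalar_prod_transpose[of "U\<^sup>T" "card I" p x "A *\<^sub>v (U *\<^sub>v x)"] A U x Ux by simp
    ultimately show ?thesis using A U x by (simp add: assoc_mult_vec_dim)
  qed
  show "spd_mat (submatrix A I I)"
    unfolding spd_mat_def symmetric_mat_def eq using sym pos A U by auto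
qed

text \<open>The inverse of the block $A_I$, padded with zeros to the size of $A$.\<close>

definition block_inverse :: "nat \<Rightarrow> real mat \<Rightarrow> nat set \<Rightarrow> real mat" where
  "block_inverse p A I
     = selection_mat p I * mat_inv (submatrix A I I) * (selection_mat p I)\<^sup>T"

text \<open>The projection along the coordinate subspace of $I$ onto its $A$-orthogonal complement.\<close>

definition block_coprojection :: "nat \<Rightarrow> real mat \<Rightarrow> nat set \<Rightarrow> real mat" where
  "block_coprojection p A I = 1\<^sub>m p - block_inverse p A I * A"

context
  fixes p :: nat and A :: "real mat" and I :: "nat set"
  assumes A: "A \<in> carrier_mat p p" and spd: "spd_mat A" and I: "I \<subseteq> {0..<p}"
begin

lemma block_inverse_carrier: "block_inverse p A I \<in> carrier_mat p p"
  using spd_mat_inverse(1)[OF spd_submatrix[OF A spd I]]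
  by (auto simp: block_inverse_def)

lemma block_coprojection_carrier: "block_coprojection p A I \<in> carrier_mat p p"
  using block_inverse_carrier A by (auto simp: block_coprojection_def)

lemma transpose_block_inverse: "(block_inverse p A I)\<^sup>T = block_inverse p A I"
  using spd_mat_inverse(1,4)[OF spd_submatrix[OF A spd I]]
  by (simp add: block_inverse_def transpose_mult_dim assoc_mult_dim)

lemma transpose_block_coprojection: "(block_coprojection p A I)\<^sup>T = 1\<^sub>m p - A * block_inverse p A I"
proof -
  have "(block_coprojection p A I)\<^sup>T = (1\<^sub>m p)\<^sup>T - (block_inverse p A I * A)\<^sup>T"
    unfolding block_coprojection_def
    by (rule transpose_minus[of _ p p]) (use A block_inverse_carrier in auto)
  then show ?thesis
    using A block_inverse_carrier
    by (simp add: transpose_mult_dim transpose_block_inverse spd_matD(1)[OF spd A])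
qed

text \<open>On vectors supported on \<^term>\<open>I\<close> the padded inverse acts as an inverse of \<^term>\<open>A\<close>; the
  second equation is the transpose of the first.\<close>

lemma block_inverse_on_block:
  "block_inverse p A I * (A * selection_mat p I) = selection_mat p I" (is ?r)
  "(selection_mat p I)\<^sup>T * (A * block_inverse p A I) = (selection_mat p I)\<^sup>T" (is ?l)
proof -
  define U P where "U = selection_mat p I" and "P = mat_inv (submatrix A I I)"
  have U: "U \<in> carrier_mat p (card I)" unfolding U_def by (rule selection_mat_carrier)
  note inv = spd_mat_inverse[OF spd_submatrix[OF A spd I], folded P_def]
  have sub: "submatrix A I I = U\<^sup>T * (A * U)"
    using selection_submatrix[OF A I I] A U by (simp add: U_def assoc_mult_dim)
  have "U * P * U\<^sup>T * (A * U) = U * (P * (U\<^sup>T * (A * U)))"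
    using U A inv(1) by (simp add: assoc_mult_dim)
  also have "\<dots> = U" using inv(3) U by (simp add: sub[symmetric])
  finally show r: ?r by (simp add: block_inverse_def U_def P_def)
  have "(block_inverse p A I * (A * U))\<^sup>T = U\<^sup>T" using r by (simp add: U_def)
  then show ?l
    using U A block_inverse_carrier
    by (simp add: transpose_mult_dim transpose_block_inverse spd_matD(1)[OF spd A]
        assoc_mult_dim U_def)
qed

text \<open>Equivalently, \<^term>\<open>block_inverse p A I * A\<close> is a projection. It is self-adjoint for the
  $A$-inner product since \<^term>\<open>block_inverse p A I\<close> is symmetric, hence an $A$-orthogonal one.\<close>

lemma block_inverse_idem:
  "block_inverse p A I * (A * block_inverse p A I) = block_inverse p A I"
proof -
  let ?U = "selection_mat p I" and ?G = "block_inverse p A I" and ?P = "mat_inv (submatrix A I I)"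
  have P: "?P \<in> carrier_mat (card I) (card I)"
    by (rule spd_mat_inverse(1)[OF spd_submatrix[OF A spd I]])
  have "?G * (A * ?G) = ?G * (A * ?U) * (?P * ?U\<^sup>T)"
    unfolding block_inverse_def using A P by (simp add: assoc_mult_dim)
  also have "\<dots> = ?G"
    unfolding block_inverse_on_block(1) using P by (simp add: block_inverse_def assoc_mult_dim)
  finally show ?thesis .
qed

text \<open>Pythagoras for the $A$-orthogonal projection with matrix \<^term>\<open>block_inverse p A I * A\<close>.\<close>

lemma block_coprojection_energy:
  assumes x: "x \<in> carrier_vec p"
  defines "y \<equiv> block_coprojection p A I *\<^sub>v x" and "z \<equiv> block_inverse p A I *\<^sub>v (A *\<^sub>v x)"
  shows "y \<bullet> (A *\<^sub>v y) = x \<bullet> (A *\<^sub>v x) - z \<bullet> (A *\<^sub>v z)"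
proof -
  let ?G = "block_inverse p A I"
  have G: "?G \<in> carrier_mat p p" by (rule block_inverse_carrier)
  define v where "v = A *\<^sub>v x"
  have v: "v \<in> carrier_vec p" and z: "z \<in> carrier_vec p" and Az: "A *\<^sub>v z \<in> carrier_vec p"
    using A x G by (auto simp: v_def z_def)
  have y: "y = x - z"
    using A x G by (simp add: y_def z_def block_coprojection_def assoc_mult_vec_dim
        minus_mult_distrib_mat_vec[of _ p p])
  have Gv: "?G *\<^sub>v (A *\<^sub>v z) = z"
    using arg_cong[OF block_inverse_idem, of "\<lambda>M. M *\<^sub>v v"] A G v
    by (simp add: z_def v_def[symmetric] assoc_mult_vec_dim)
  have zz: "z \<bullet> (A *\<^sub>v z) = z \<bullet> v"
    using scalar_prod_transpose[OF G v Az] transpose_block_inverse Gv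
      comm_scalar_prod[OF z Az] comm_scalar_prod[OF z v] comm_scalar_prod[OF v z]
      scalar_prod_transpose[OF G Az v]
    by (simp add: z_def v_def)
  have xz: "x \<bullet> (A *\<^sub>v z) = z \<bullet> v"
    using scalar_prod_transpose[OF A x z] spd_matD(1)[OF spd A] comm_scalar_prod[OF z v]
    by (simp add: v_def)
  have "A *\<^sub>v y = v - A *\<^sub>v z"
    using A x z by (simp add: y v_def mult_minus_distrib_mat_vec)
  then show ?thesis
    using x z v Az zz xz
    by (simp add: y minus_scalar_prod_distrib[of _ p] scalar_prod_minus_distrib[of _ p] v_def[symmetric])
qed

end

section \<open>Iterating the block inversion steps\<close>

locale spd_partition =
  fixes p :: nat and A :: "real mat" and I J :: "nat set"
  assumes A: "A \<in> carrier_mat p p" and spd: "spd_mat A"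
    and partition: "I \<union> J = {0..<p}" "I \<inter> J = {}"
begin

lemma subsets: "I \<subseteq> {0..<p}" "J \<subseteq> {0..<p}"
  using partition by auto

text \<open>The second step of an iteration is the first one with the two index sets exchanged.\<close>

lemma swap: "spd_partition p A J I"
  using A spd partition by unfold_locales auto

text \<open>The four block formulas, assembled, are a single congruence of the whole matrix. That the
  right-hand side may contain \<^term>\<open>Z\<close> and not only its block on \<^term>\<open>J\<close> is what allows errors to be
  propagated without splitting them into blocks.\<close>

lemma ibmi_step_eq:
  assumes Z: "Z \<in> carrier_mat p p"
  shows "ibmi_step p A I J (submatrix Z J J)
    = block_inverse p A I + block_coprojection p A I * Z * (block_coprojection p A I)\<^sup>T"
proof -
  define U V P where "U = selection_mat p I" and "V = selection_mat p J"
    and "P = mat_inv (submatrix A I I)"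
  have dims [simp]: "dim_row U = p" "dim_col U = card I" "dim_row V = p" "dim_col V = card J"
    "dim_row Z = p" "dim_col Z = p" "dim_row A = p" "dim_col A = p"
    using A Z by (auto simp: U_def V_def)
  have P: "P \<in> carrier_mat (card I) (card I)"
    unfolding P_def by (rule spd_mat_inverse(1)[OF spd_submatrix[OF A spd subsets(1)]])
  then have [simp]: "dim_row P = card I" "dim_col P = card I" by auto
  have UA: "submatrix A I J = U\<^sup>T * A * V" "submatrix A J I = V\<^sup>T * A * U"
    "submatrix Z J J = V\<^sup>T * Z * V"
    using selection_submatrix[OF A subsets(1,2)] selection_submatrix[OF A subsets(2,1)]
      selection_submatrix[OF Z subsets(2,2)] by (simp_all add: U_def V_def)
  define G where "G = block_inverse p A I"
  have GU: "G = U * P * U\<^sup>T" by (simp add: G_def block_inverse_def U_def P_def)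
  then have [simp]: "dim_row G = p" "dim_col G = p" by auto
  define Y where "Y = V * (V\<^sup>T * Z * V) * V\<^sup>T"
  have [simp]: "dim_row Y = p" "dim_col Y = p" by (auto simp: Y_def)
  define D where "D = 1\<^sub>m p - G * A"
  have D: "block_coprojection p A I = D" "D\<^sup>T = 1\<^sub>m p - A * G"
    using transpose_block_coprojection[OF A spd subsets(1)]
    by (simp_all add: D_def G_def block_coprojection_def)
  have [simp]: "dim_row D = p" "dim_col D = p" by (auto simp: D_def)
  let ?X = "V\<^sup>T * Z * V"
  have "ibmi_step p A I J (submatrix Z J J)
    = (U * (P + P * (U\<^sup>T * A * V) * ?X * (V\<^sup>T * A * U) * P) * U\<^sup>T
       + U * (- (P * (U\<^sup>T * A * V) * ?X)) * V\<^sup>T)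
      + (V * (- (?X * (V\<^sup>T * A * U) * P)) * U\<^sup>T + V * ?X * V\<^sup>T)"
    unfolding ibmi_step_def Let_def UA P_def[symmetric]
    unfolding U_def V_def
    by (rule mat_of_blocks_eq_selection[OF partition])
      (auto simp: U_def[symmetric] V_def[symmetric])
  also have "\<dots> = (G + G * A * Y * A * G - G * A * Y) + (Y - Y * A * G)"
    unfolding GU Y_def
    by (intro eq_matI) (simp_all add: mat_ring_simps del: index_mult_mat(1))
  also have "\<dots> = G + D * Y * D\<^sup>T"
    unfolding D(2) unfolding D_def
    by (intro eq_matI) (simp_all add: mat_ring_simps del: index_mult_mat(1))
  also have "D * Y * D\<^sup>T = D * Z * D\<^sup>T"
  proof -
    \<comment> \<open>Since \<^term>\<open>D\<close> annihilates the vectors supported on \<^term>\<open>I\<close>, the product depends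
      on the block of \<^term>\<open>Z\<close> at \<^term>\<open>J\<close> only.\<close>
    have "D * U = 0\<^sub>m p (card I)"
      using block_inverse_on_block(1)[OF A spd subsets(1)]
      by (simp add: D_def G_def[symmetric] U_def[symmetric] mat_ring_simps minus_self_dim)
    then have DU: "D * (U * U\<^sup>T) = 0\<^sub>m p p"
      by (simp add: assoc_mult_dim[symmetric])
    have "D = D * (U * U\<^sup>T + V * V\<^sup>T)"
      using selection_partition[OF partition] by (simp add: U_def V_def mult_one_dim D_def)
    also have "\<dots> = D * (V * V\<^sup>T)"
      by (simp add: mult_add_dim DU zero_add_dim)
    finally have DV: "D * (V * V\<^sup>T) = D" by simp
    then have "(D * (V * V\<^sup>T))\<^sup>T = D\<^sup>T" by simp
    then have VD: "V * V\<^sup>T * D\<^sup>T = D\<^sup>T" by (simp add: transpose_mult_dim)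
    have "D * Y * D\<^sup>T = (D * (V * V\<^sup>T)) * Z * (V * V\<^sup>T * D\<^sup>T)"
      by (simp add: Y_def assoc_mult_dim)
    then show ?thesis by (simp only: DV VD)
  qed
  finally show ?thesis by (simp add: D G_def)
qed

text \<open>With $H = A^{-1}$ and $D = 1 - GA$, expanding gives $D H D^T = H - 2G + GAG = H - G$.\<close>

lemma inverse_fixpoint:
  "block_inverse p A I + block_coprojection p A I * mat_inv A * (block_coprojection p A I)\<^sup>T = mat_inv A"
proof -
  define G H where "G = block_inverse p A I" and "H = mat_inv A"
  have G: "G \<in> carrier_mat p p" unfolding G_def by (rule block_inverse_carrier[OF A spd subsets(1)])
  note H = spd_mat_inverse[OF A spd, folded H_def]
  have GAG: "G * (A * G) = G" unfolding G_def by (rule block_inverse_idem[OF A spd subsets(1)])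
  have AHG: "A * (H * M) = M" "H * (A * M) = M" if "M \<in> carrier_mat p p" for M
    using H A that by (simp_all add: assoc_mult_dim[symmetric] mult_one_dim)
  have "G + (1\<^sub>m p - G * A) * H * (1\<^sub>m p - A * G) = H"
    using A G H by (intro eq_matI) (simp_all add: mat_ring_simps GAG AHG del: index_mult_mat(1))
  then show ?thesis
    unfolding transpose_block_coprojection[OF A spd subsets(1)]
    by (simp add: block_coprojection_def G_def H_def)
qed

lemma ibmi_step_error:
  assumes Z: "Z \<in> carrier_mat p p"
  shows "ibmi_step p A I J (submatrix Z J J) - mat_inv A
    = block_coprojection p A I * (Z - mat_inv A) * (block_coprojection p A I)\<^sup>T"
proof -
  define G D H where "G = block_inverse p A I" and "D = block_coprojection p A I" and "H = mat_inv A"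
  have [simp]: "dim_row G = p" "dim_col G = p" "dim_row D = p" "dim_col D = p"
      "dim_row H = p" "dim_col H = p" "dim_row Z = p" "dim_col Z = p"
    using Z block_inverse_carrier[OF A spd subsets(1)] block_coprojection_carrier[OF A spd subsets(1)]
      spd_mat_inverse(1)[OF A spd] by (auto simp: G_def D_def H_def)
  have fixpt: "G + D * H * D\<^sup>T = H"
    using inverse_fixpoint by (simp add: G_def D_def H_def)
  have "(G + D * Z * D\<^sup>T) - (G + D * H * D\<^sup>T) = D * (Z - H) * D\<^sup>T"
    by (intro eq_matI) (simp_all add: mat_ring_simps del: index_mult_mat(1))
  then show ?thesis
    unfolding ibmi_step_eq[OF Z] fixpt by (simp add: G_def D_def H_def)
qed

text \<open>If \<^term>\<open>y\<close> is the image of the first projection, the norm that the second one removes from it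
  dominates the Euclidean norm of $w = A y$, and this in turn dominates the norm of \<^term>\<open>y\<close>. The
  geometric content is that the ranges of the two projections meet only in zero, here in a
  quantitative form.\<close>

lemma residual_contraction:
  obtains q where "0 \<le> q" "q < 1"
    "\<And>x y. x \<in> carrier_vec p \<Longrightarrow> y = block_coprojection p A J *\<^sub>v (block_coprojection p A I *\<^sub>v x)
      \<Longrightarrow> y \<bullet> (A *\<^sub>v y) \<le> q * (x \<bullet> (A *\<^sub>v x))"
proof -
  define H where "H = mat_inv A"
  note H = spd_mat_inverse[OF A spd, folded H_def]
  obtain C where C: "C \<ge> 0" "\<And>w. w \<in> carrier_vec p \<Longrightarrow> w \<bullet> (A *\<^sub>v w) \<le> C * (w \<bullet> w)"
    using quadratic_form_bounded[OF A] by blast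
  obtain B where B: "B \<ge> 0" "\<And>w. w \<in> carrier_vec p \<Longrightarrow> w \<bullet> (H *\<^sub>v w) \<le> B * (w \<bullet> w)"
    using quadratic_form_bounded[OF H(1)] by blast
  \<comment> \<open>The estimates below yield the factor \<^term>\<open>B * C\<close>; adding 1 makes it a legitimate divisor
    and keeps the contraction factor nonnegative.\<close>
  define K where "K = B * C + 1"
  have K: "K \<ge> 1" using B(1) C(1) by (simp add: K_def)
  define U V where "U = selection_mat p I" and "V = selection_mat p J"
  have UV [simp]: "dim_row U = p" "dim_col U = card I" "dim_row V = p" "dim_col V = card J"
    by (auto simp: U_def V_def)
  have dA [simp]: "dim_row A = p" "dim_col A = p" using A by auto
  define E F S where "E = block_coprojection p A I" and "F = block_coprojection p A J"
    and "S = block_inverse p A J"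
  have E: "E \<in> carrier_mat p p" and F: "F \<in> carrier_mat p p" and S: "S \<in> carrier_mat p p"
    using block_coprojection_carrier[OF A spd subsets(1)] block_coprojection_carrier[OF A spd subsets(2)]
      block_inverse_carrier[OF A spd subsets(2)] by (auto simp: E_def F_def S_def)
  \<comment> \<open>The matrix \<^term>\<open>A\<close> maps the range of the first projection to vectors supported on \<^term>\<open>J\<close>.\<close>
  have supp: "V * V\<^sup>T * (A * E) = A * E"
  proof -
    have G: "block_inverse p A I \<in> carrier_mat p p"
      by (rule block_inverse_carrier[OF A spd subsets(1)])
    have "U\<^sup>T * (A * E) = U\<^sup>T * A - U\<^sup>T * (A * block_inverse p A I) * A"
      using G by (simp add: E_def block_coprojection_def mat_ring_simps)
    also have "\<dots> = 0\<^sub>m (card I) p"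
      using block_inverse_on_block(2)[OF A spd subsets(1)] by (simp add: U_def minus_self_dim)
    finally have "U * (U\<^sup>T * (A * E)) = 0\<^sub>m p p" using right_mult_zero_mat[of U p "card I" p]
      by (simp add: carrier_matI)
    moreover have "A * E = (U * U\<^sup>T + V * V\<^sup>T) * (A * E)"
      using selection_partition[OF partition] E by (simp add: U_def V_def mult_one_dim)
    ultimately show ?thesis using E by (simp add: mat_ring_simps zero_add_dim)
  qed
  have VS: "V\<^sup>T * (A * S) = V\<^sup>T"
    unfolding V_def S_def by (rule block_inverse_on_block(2)[OF A spd subsets(2)])
  have energy: "(F *\<^sub>v (E *\<^sub>v x)) \<bullet> (A *\<^sub>v (F *\<^sub>v (E *\<^sub>v x))) \<le> (1 - 1 / K) * (x \<bullet> (A *\<^sub>v x))"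
    if x: "x \<in> carrier_vec p" for x
  proof -
    define y w z where "y = E *\<^sub>v x" and "w = A *\<^sub>v y" and "z = S *\<^sub>v w"
    have y: "y \<in> carrier_vec p" unfolding y_def by (rule mult_mat_vec_carrier[OF E x])
    have w: "w \<in> carrier_vec p" unfolding w_def by (rule mult_mat_vec_carrier[OF A y])
    have z: "z \<in> carrier_vec p" unfolding z_def by (rule mult_mat_vec_carrier[OF S w])
    have VT: "V\<^sup>T \<in> carrier_mat (card J) p"
      by (rule carrier_matI)
        (simp_all only: index_transpose_mat UV)
    note carr = y w z mult_mat_vec_carrier[OF VT w] mult_mat_vec_carrier[OF A z]
    have wV: "w = V *\<^sub>v (V\<^sup>T *\<^sub>v w)"
      using arg_cong[OF supp, of "\<lambda>M. M *\<^sub>v x"] E x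
      by (simp add: w_def y_def assoc_mult_vec_dim)
    have "V\<^sup>T *\<^sub>v (A *\<^sub>v z) = V\<^sup>T *\<^sub>v w"
      using arg_cong[OF VS, of "\<lambda>M. M *\<^sub>v w"] S carr
      by (simp add: z_def assoc_mult_vec_dim)
    then have "w \<bullet> w = (V\<^sup>T *\<^sub>v w) \<bullet> (V\<^sup>T *\<^sub>v (A *\<^sub>v z))"
      using scalar_prod_transpose[of V p "card J" w "V\<^sup>T *\<^sub>v w"] carr wV
      by (simp add: carrier_matI)
    also have "\<dots> = (V *\<^sub>v (V\<^sup>T *\<^sub>v w)) \<bullet> (A *\<^sub>v z)"
      using scalar_prod_transpose[of "V\<^sup>T" "card J" p "V\<^sup>T *\<^sub>v w" "A *\<^sub>v z"] carr
      by (simp add: carrier_matI)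
    finally have ww: "w \<bullet> w = w \<bullet> (A *\<^sub>v z)" by (simp only: wV[symmetric])
    have zz: "z \<bullet> (A *\<^sub>v z) \<ge> 0" by (rule spd_matD(3)[OF spd A carr(3)])
    have "(w \<bullet> w)\<^sup>2 \<le> (w \<bullet> (A *\<^sub>v w)) * (z \<bullet> (A *\<^sub>v z))"
      using spd_Cauchy_Schwarz[OF A spd carr(2,3)] by (simp add: ww[symmetric])
    also have "\<dots> \<le> C * (w \<bullet> w) * (z \<bullet> (A *\<^sub>v z))"
      by (intro mult_right_mono C carr zz)
    finally have "(w \<bullet> w) * (w \<bullet> w) \<le> (w \<bullet> w) * (C * (z \<bullet> (A *\<^sub>v z)))"
      by (simp add: power2_eq_square mult_ac)
    moreover have "w \<bullet> w \<ge> 0" by (simp add: scalar_prod_def sum_nonneg)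
    ultimately have wz: "w \<bullet> w \<le> C * (z \<bullet> (A *\<^sub>v z))"
      using C(1) zz by (cases "w \<bullet> w = 0") (auto simp: mult_le_cancel_left)
    have "H *\<^sub>v w = y"
      using arg_cong[OF H(3), of "\<lambda>M. M *\<^sub>v y"] H(1) carr by (simp add: w_def assoc_mult_vec_dim)
    then have "y \<bullet> (A *\<^sub>v y) = w \<bullet> (H *\<^sub>v w)"
      using comm_scalar_prod[OF carr(1,2)] by (simp add: w_def)
    also have "\<dots> \<le> B * (C * (z \<bullet> (A *\<^sub>v z)))"
      using B(2)[OF carr(2)] mult_left_mono[OF wz B(1)] by simp
    also have "\<dots> \<le> K * (z \<bullet> (A *\<^sub>v z))"
      using zz by (simp add: K_def algebra_simps)
    finally have "(1 / K) * (y \<bullet> (A *\<^sub>v y)) \<le> z \<bullet> (A *\<^sub>v z)"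
      using K by (simp add: field_simps)
    moreover have "(F *\<^sub>v y) \<bullet> (A *\<^sub>v (F *\<^sub>v y)) = y \<bullet> (A *\<^sub>v y) - z \<bullet> (A *\<^sub>v z)"
      unfolding F_def z_def S_def w_def
      by (rule block_coprojection_energy[OF A spd subsets(2) carr(1)])
    ultimately have "(F *\<^sub>v y) \<bullet> (A *\<^sub>v (F *\<^sub>v y)) \<le> (1 - 1 / K) * (y \<bullet> (A *\<^sub>v y))"
      by (simp add: left_diff_distrib)
    also have "y \<bullet> (A *\<^sub>v y) \<le> x \<bullet> (A *\<^sub>v x)"
    proof -
      let ?v = "block_inverse p A I *\<^sub>v (A *\<^sub>v x)"
      have "?v \<in> carrier_vec p"
        using block_inverse_carrier[OF A spd subsets(1)] A x by auto
      from spd_matD(3)[OF spd A this] block_coprojection_energy[OF A spd subsets(1) x]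
      show ?thesis by (simp add: y_def E_def)
    qed
    then have "(1 - 1 / K) * (y \<bullet> (A *\<^sub>v y)) \<le> (1 - 1 / K) * (x \<bullet> (A *\<^sub>v x))"
      using K by (intro mult_left_mono) auto
    finally show ?thesis by (simp add: y_def)
  qed
  show thesis
    by (rule that[of "1 - 1 / K"]) (use K energy in \<open>auto simp: E_def F_def\<close>)
qed

text \<open>The matrix by which one complete iteration conjugates the error.\<close>

definition sweep :: "real mat" where
  "sweep = block_coprojection p A J * block_coprojection p A I"

lemma sweep_carrier: "sweep \<in> carrier_mat p p"
  using block_coprojection_carrier[OF A spd subsets(1)] block_coprojection_carrier[OF A spd subsets(2)]
  by (auto simp: sweep_def)

text \<open>The columns of the powers decay geometrically in the norm of \<^term>\<open>A\<close>, hence so do their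
  entries.\<close>

lemma sweep_pow_tendsto_0:
  assumes i: "i < p" and j: "j < p"
  shows "(\<lambda>r. (sweep ^\<^sub>m r) $$ (i, j)) \<longlonglongrightarrow> 0"
proof -
  obtain q where q: "0 \<le> q" "q < 1"
    and contr: "\<And>x y. x \<in> carrier_vec p \<Longrightarrow>
      y = block_coprojection p A J *\<^sub>v (block_coprojection p A I *\<^sub>v x)
      \<Longrightarrow> y \<bullet> (A *\<^sub>v y) \<le> q * (x \<bullet> (A *\<^sub>v x))"
    using residual_contraction by blast
  have dims: "dim_row (block_coprojection p A I) = p" "dim_col (block_coprojection p A I) = p"
    "dim_col (block_coprojection p A J) = p"
    using block_coprojection_carrier[OF A spd subsets(1)] block_coprojection_carrier[OF A spd subsets(2)]
    by auto
  note T = sweep_carrier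
  have pow: "sweep ^\<^sub>m r \<in> carrier_mat p p" for r using T by auto
  have contr_pow: "(sweep ^\<^sub>m r *\<^sub>v x) \<bullet> (A *\<^sub>v (sweep ^\<^sub>m r *\<^sub>v x)) \<le> q ^ r * (x \<bullet> (A *\<^sub>v x))"
    if "x \<in> carrier_vec p" for r x
    using that
  proof (induction r arbitrary: x)
    case 0
    then show ?case using T by simp
  next
    case (Suc r)
    have Tx: "sweep *\<^sub>v x \<in> carrier_vec p" using T Suc.prems by auto
    have "sweep ^\<^sub>m Suc r *\<^sub>v x = sweep ^\<^sub>m r *\<^sub>v (sweep *\<^sub>v x)"
      using T Suc.prems by (simp add: assoc_mult_vec_dim carrier_matD[OF T])
    moreover have "(sweep *\<^sub>v x) \<bullet> (A *\<^sub>v (sweep *\<^sub>v x)) \<le> q * (x \<bullet> (A *\<^sub>v x))"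
      by (rule contr[OF Suc.prems]) (use Suc.prems dims in \<open>simp add: sweep_def assoc_mult_vec_dim\<close>)
    then have "q ^ r * ((sweep *\<^sub>v x) \<bullet> (A *\<^sub>v (sweep *\<^sub>v x))) \<le> q ^ r * (q * (x \<bullet> (A *\<^sub>v x)))"
      using q by (intro mult_left_mono) auto
    ultimately show ?case using Suc.IH[OF Tx] by (simp add: mult_ac)
  qed
  define h a where "h = mat_inv A $$ (i, i)" and "a = A $$ (j, j)"
  have e: "unit_vec p j \<in> carrier_vec p" by simp
  have ea: "unit_vec p j \<bullet> (A *\<^sub>v unit_vec p j) = a" using A j by (simp add: a_def)
  have "((sweep ^\<^sub>m r) $$ (i, j))\<^sup>2 \<le> \<bar>h\<bar> * (q ^ r * a)" for r
  proof -
    define x where "x = sweep ^\<^sub>m r *\<^sub>v unit_vec p j"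
    have x: "x \<in> carrier_vec p" using pow[of r] by (simp add: x_def)
    have "(sweep ^\<^sub>m r) $$ (i, j) = x $ i"
      using i j by (simp add: x_def carrier_matD[OF T])
    then have "((sweep ^\<^sub>m r) $$ (i, j))\<^sup>2 \<le> h * (x \<bullet> (A *\<^sub>v x))"
      using index_square_le_spd[OF A spd x i] by (simp add: h_def)
    also have "\<dots> \<le> \<bar>h\<bar> * (x \<bullet> (A *\<^sub>v x))"
      using spd_matD(3)[OF spd A x] by (intro mult_right_mono) auto
    also have "\<dots> \<le> \<bar>h\<bar> * (q ^ r * a)"
      using contr_pow[OF e, of r] by (intro mult_left_mono) (auto simp: ea x_def)
    finally show ?thesis .
  qed
  then have bound: "\<forall>r. ((sweep ^\<^sub>m r) $$ (i, j))\<^sup>2 \<le> \<bar>h\<bar> * (q ^ r * a)" by blast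
  have "(\<lambda>r. \<bar>h\<bar> * (q ^ r * a)) \<longlonglongrightarrow> \<bar>h\<bar> * (0 * a)"
    using q by (intro tendsto_intros LIMSEQ_power_zero) auto
  then have lim: "(\<lambda>r. \<bar>h\<bar> * (q ^ r * a)) \<longlonglongrightarrow> 0" by simp
  have "(\<lambda>r. ((sweep ^\<^sub>m r) $$ (i, j))\<^sup>2) \<longlonglongrightarrow> 0"
    by (rule tendsto_sandwich[OF always_eventually always_eventually[OF bound] tendsto_const lim])
      simp
  then show ?thesis by (subst (asm) power_tendsto_0_iff) simp_all
qed

lemma ibmi_carrier: "ibmi p A I J X0 r \<in> carrier_mat p p"
  by (cases r) (simp_all add: Let_def ibmi_step_def mat_of_blocks_carrier)

lemma ibmi_error:
  "ibmi p A I J X0 r - mat_inv A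
    = sweep ^\<^sub>m r * (ibmi p A I J X0 0 - mat_inv A) * (sweep ^\<^sub>m r)\<^sup>T"
proof (induction r)
  case 0
  have "ibmi p A I J X0 0 - mat_inv A \<in> carrier_mat p p"
    using spd_mat_inverse(1)[OF A spd] by auto
  then show ?case using sweep_carrier
    by (simp add: mult_one_dim carrier_matD[OF sweep_carrier]
        carrier_matD[OF spd_mat_inverse(1)[OF A spd]])
next
  case (Suc r)
  interpret swapped: spd_partition p A J I by (rule swap)
  define E F where "E = block_coprojection p A I" and "F = block_coprojection p A J"
  have EF [simp]: "dim_row E = p" "dim_col E = p" "dim_row F = p" "dim_col F = p"
    using block_coprojection_carrier[OF A spd subsets(1)] block_coprojection_carrier[OF A spd subsets(2)]
    by (auto simp: E_def F_def)
  have sw: "sweep = F * E" by (simp add: sweep_def E_def F_def)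
  define H where "H = mat_inv A"
  have [simp]: "dim_row H = p" "dim_col H = p" using spd_mat_inverse(1)[OF A spd] by (auto simp: H_def)
  define Z where "Z = ibmi p A I J X0 r"
  have Z: "Z \<in> carrier_mat p p" unfolding Z_def by (rule ibmi_carrier)
  define Z' where "Z' = ibmi_step p A I J (submatrix Z J J)"
  have Z': "Z' \<in> carrier_mat p p" by (simp add: Z'_def ibmi_step_def Let_def mat_of_blocks_carrier)
  define T D where "T = sweep ^\<^sub>m r" and "D = ibmi p A I J X0 0 - H"
  have [simp]: "dim_row T = p" "dim_col T = p" using sweep_carrier by (auto simp: T_def)
  have [simp]: "dim_row D = p" "dim_col D = p" by (auto simp: D_def)
  have comm: "sweep * T = T * sweep"
    unfolding T_def
  proof (induction r)
    case 0
    then show ?case using sweep_carrier by simp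
  next
    case (Suc r)
    have "sweep * sweep ^\<^sub>m Suc r = sweep * sweep ^\<^sub>m r * sweep"
      using sweep_carrier by (simp add: assoc_mult_dim carrier_matD[OF sweep_carrier])
    then show ?case using Suc by simp
  qed
  have "ibmi p A I J X0 (Suc r) - H = ibmi_step p A J I (submatrix Z' I I) - H"
    by (simp add: Let_def Z'_def Z_def)
  also have "\<dots> = F * (Z' - H) * F\<^sup>T"
    using swapped.ibmi_step_error[OF Z'] by (simp add: F_def H_def)
  also have "Z' - H = E * (Z - H) * E\<^sup>T"
    using ibmi_step_error[OF Z] by (simp add: Z'_def E_def H_def)
  also have "Z - H = T * D * T\<^sup>T"
    using Suc.IH by (simp only: Z_def T_def D_def H_def)
  also have "F * (E * (T * D * T\<^sup>T) * E\<^sup>T) * F\<^sup>T = (sweep * T) * D * (sweep * T)\<^sup>T"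
    by (simp add: sw transpose_mult_dim assoc_mult_dim)
  finally show ?case
    unfolding comm by (simp add: T_def D_def H_def)
qed

text \<open>Each entry of the error is a fixed finite bilinear expression in the entries of the power of
  \<^term>\<open>sweep\<close>, all of which tend to zero.\<close>

lemma ibmi_tendsto: "mat_tendsto (ibmi p A I J X0) (mat_inv A)"
proof -
  define H D where "H = mat_inv A" and "D = ibmi p A I J X0 0 - H"
  have H: "H \<in> carrier_mat p p" unfolding H_def by (rule spd_mat_inverse(1)[OF A spd])
  then have D: "D \<in> carrier_mat p p" by (auto simp: D_def)
  have "(\<lambda>r. ibmi p A I J X0 r $$ (i, j)) \<longlonglongrightarrow> H $$ (i, j)" if ij: "i < p" "j < p" for i j
  proof -
    have entry: "ibmi p A I J X0 r $$ (i, j) - H $$ (i, j)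
      = (\<Sum>l = 0..<p. (\<Sum>k = 0..<p. (sweep ^\<^sub>m r) $$ (i, k) * D $$ (k, l)) * (sweep ^\<^sub>m r) $$ (j, l))"
      for r
    proof -
      have T: "sweep ^\<^sub>m r \<in> carrier_mat p p" using sweep_carrier by auto
      have "ibmi p A I J X0 r $$ (i, j) - H $$ (i, j) = (ibmi p A I J X0 r - H) $$ (i, j)"
        using H ij by simp
      also have "\<dots> = (sweep ^\<^sub>m r * D * (sweep ^\<^sub>m r)\<^sup>T) $$ (i, j)"
        by (simp only: ibmi_error[of X0 r] H_def D_def)
      finally show ?thesis using T D ij by (simp add: scalar_prod_def
            carrier_matD[OF sweep_carrier] del: assoc_mult_mat)
    qed
    have "(\<lambda>r. \<Sum>l = 0..<p. (\<Sum>k = 0..<p. (sweep ^\<^sub>m r) $$ (i, k) * D $$ (k, l)) * (sweep ^\<^sub>m r) $$ (j, l))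
        \<longlonglongrightarrow> (\<Sum>l = 0..<p. (\<Sum>k = 0..<p. 0 * D $$ (k, l)) * 0)"
      using ij by (intro tendsto_intros sweep_pow_tendsto_0) auto
    then have "(\<lambda>r. ibmi p A I J X0 r $$ (i, j) - H $$ (i, j)) \<longlonglongrightarrow> 0"
      unfolding entry by simp
    then show ?thesis by (rule LIM_zero_cancel)
  qed
  then show ?thesis
    using H ibmi_carrier by (auto simp: mat_tendsto_def H_def[symmetric])
qed

end

theorem corollary3p4:
  fixes p :: nat and A X0 :: "real mat" and I1 I2 :: "nat set"
  assumes "A \<in> carrier_mat p p" and "spd_mat A"
    and "I1 \<noteq> {}" and "I2 \<noteq> {}"
    and "I1 \<union> I2 = {0..<p}" and "I1 \<inter> I2 = {}"
    and "X0 \<in> carrier_mat (card I2) (card I2)" and "spd_mat X0"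
  shows "mat_tendsto (\<lambda>r. ibmi p A I1 I2 X0 r) (mat_inv A)"
proof -
  interpret spd_partition p A I1 I2
    using assms by unfold_locales auto
  show ?thesis by (rule ibmi_tendsto)
qed

end
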